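(* For all non-negative integers $m$ and $n$ and every positive integer $r$, $$\sum_{k_1,\dots,k_r=-n}^n\ \prod_{1\le i<j\le r}(k_i-k_j)^2\ \prod_{i=1}^r|k_i|\binom{2n}{n+k_i}\binom{2m}{m+k_i}$$ $$=r!\prod_{i=1}^{\lceil r/2\rceil}\frac{\Gamma(i)^2\,\Gamma(2n+1)\,\Gamma(2m+1)\,\Gamma(m+n-i-\lceil r/2\rceil+2)}{\Gamma(n-i+2)\,\Gamma(n-i+1)\,\Gamma(m-i+2)\,\Gamma(m-i+1)\,\Gamma(m+n-i+2)}$$ $$\times\prod_{i=1}^{\lfloor r/2\rfloor}\frac{\Gamma(i)\,\Gamma(i+1)\,\Gamma(2n+1)\,\Gamma(2m+1)\,\Gamma(m+n-i-\lfloor r/2\rfloor+1)}{\Gamma(n-i+1)^2\,\Gamma(m-i+1)^2\,\Gamma(m+n-i+2)}.$$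
   Context: Binomial coefficients $\binom{N}{M}$ with $M<0$ or $M>N$ are $0$. Convention: $1/\Gamma(x)=0$ for $x\in\{0,-1,-2,\dots\}$; if a numerator factor on the right-hand side has a pole, the right-hand side is understood as its limiting value when $m,n$ are replaced by $m+\varepsilon,n+\varepsilon$ and $\varepsilon\to0$. *)

theory Defs
  imports "HOL-Analysis.Analysis"
begin

(* Binomial coefficient with integer lower index. The guard is needed because nat truncates
   negative integers to 0; for M > N the library's choose already gives 0. *)
definition binom :: "nat \<Rightarrow> int \<Rightarrow> nat" where
  "binom N M = (if M < 0 then 0 else N choose nat M)"

definition weighted_sum :: "nat \<Rightarrow> nat \<Rightarrow> nat \<Rightarrow> real" where
  "weighted_sum r m n =
     (\<Sum>k \<in> {1..r} \<rightarrow>\<^sub>E {- int n..int n}.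
        (\<Prod>i\<in>{1..r}. \<Prod>j\<in>{i<..r}. (of_int (k i - k j))\<^sup>2) *
        (\<Prod>i\<in>{1..r}. of_int \<bar>k i\<bar> *
           real (binom (2 * n) (int n + k i)) * real (binom (2 * m) (int m + k i))))"

(* m and n are real so that they can be perturbed by epsilon. At a pole the library's Gamma
   is 0 and x / 0 = 0, so a denominator factor Gamma x at a pole acts as 1 / Gamma x = 0. *)
definition gamma_product :: "nat \<Rightarrow> real \<Rightarrow> real \<Rightarrow> real" where
  "gamma_product r m n =
     fact r *
     (\<Prod>i = 1..nat \<lceil>real r / 2\<rceil>.
        ((Gamma (real i))\<^sup>2 * Gamma (2 * n + 1) * Gamma (2 * m + 1) *
         Gamma (m + n - real i - real_of_int \<lceil>real r / 2\<rceil> + 2)) /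
        (Gamma (n - real i + 2) * Gamma (n - real i + 1) *
         Gamma (m - real i + 2) * Gamma (m - real i + 1) *
         Gamma (m + n - real i + 2))) *
     (\<Prod>i = 1..nat \<lfloor>real r / 2\<rfloor>.
        (Gamma (real i) * Gamma (real i + 1) * Gamma (2 * n + 1) * Gamma (2 * m + 1) *
         Gamma (m + n - real i - real_of_int \<lfloor>real r / 2\<rfloor> + 1)) /
        ((Gamma (n - real i + 1))\<^sup>2 * (Gamma (m - real i + 1))\<^sup>2 *
         Gamma (m + n - real i + 2)))"

(* Some numerator factor of gamma_product has a pole. The factors Gamma i, Gamma (i + 1),
   Gamma (2 n + 1) and Gamma (2 m + 1) have positive arguments for natural m, n and i >= 1. *)
definition numerator_pole :: "nat \<Rightarrow> nat \<Rightarrow> nat \<Rightarrow> bool" where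
  "numerator_pole r m n \<longleftrightarrow>
     (\<exists>i\<in>{1..nat \<lceil>real r / 2\<rceil>}.
        real m + real n - real i - real_of_int \<lceil>real r / 2\<rceil> + 2 \<in> \<int>\<^sub>\<le>\<^sub>0) \<or>
     (\<exists>i\<in>{1..nat \<lfloor>real r / 2\<rfloor>}.
        real m + real n - real i - real_of_int \<lfloor>real r / 2\<rfloor> + 1 \<in> \<int>\<^sub>\<le>\<^sub>0)"

end

theory Submission
  imports Defs "Jordan_Normal_Form.Determinant"
begin

text \<open>
  Write \<open>R\<close> and \<open>F\<close> for \<open>r / 2\<close> rounded up and down. The summand contains a squared Vandermonde
  product times a product of weights \<open>w k = |k| C(2n, n + k) C(2m, m + k)\<close>, so the sum is \<open>r!\<close> times a
  Gram determinant: for any polynomials \<open>a i\<close>, \<open>b i\<close> of degree \<open>i\<close> with matching leading coefficients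
  \<open>1\<close> or \<open>-1\<close>, its entries are the sums of \<open>w k * a i k * b j k\<close> over \<open>k\<close> (\<open>andreief\<close>, \<open>weighted_sum_eq_fdet\<close>).
  Since the weight is even, choosing \<open>a i\<close> and \<open>b i\<close> with the parity of \<open>i\<close> splits the determinant into
  blocks of sizes \<open>R\<close> and \<open>F\<close> (\<open>fdet_checkerboard\<close>).

  The essential choice is that of the polynomials. Take \<open>a (2 i)\<close> to be the product of
  \<open>(n - t)\<^sup>2 - k\<^sup>2\<close> over \<open>t < i\<close> and \<open>b (2 j)\<close> the same with \<open>m\<close>, and multiply by \<open>k\<close> for odd indices.
  Then \<open>a\<close> is absorbed by \<open>C(2n, n + k)\<close> and \<open>b\<close> by \<open>C(2m, m + k)\<close>, lowering \<open>n\<close> to \<open>n - i\<close> and \<open>m\<close> to \<open>m - j\<close>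
  (\<open>even_basis_central_binom\<close>). Each entry becomes a first or third absolute moment of a product of two
  binomial coefficients, which telescopes to a closed form (\<open>abs_moment\<close>, \<open>abs_cubed_moment\<close>). Apart from row
  and column factors the two blocks have the entries \<open>1 / (s - i - j)\<close> and \<open>1 / ((s - i - j) (s - i - j - 1))\<close>
  with \<open>s = m + n\<close>. Both are determinants of reciprocals of consecutive factors, evaluated in
  \<open>fdet_reciprocal_products\<close> by moving the points \<open>s - i\<close> to \<open>i\<close>, where the matrix is triangular.

  This argument covers \<open>r \<le> 2 * min m n\<close>, and there no Gamma factor has a pole. For larger \<open>r\<close> every
  summand vanishes, since the \<open>k i\<close> would have to be distinct, nonzero and at most \<open>min m n\<close> in absolute value.
  The Gamma product vanishes as well: directly at a point without numerator poles
  (\<open>gamma_product_nat_eq_0\<close>), and otherwise in the limit, because counting orders at \<open>\<epsilon> = 0\<close> gives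
  more zeros than poles (\<open>gamma_product_tendsto_0\<close>).
\<close>

section \<open>Determinants indexed by functions\<close>

text \<open>Matrices are given by their entry functions, so that changing the basis, reindexing rows or
  restricting to a subset of the indices amounts to substituting in the argument.\<close>
definition fdet :: "nat \<Rightarrow> (nat \<Rightarrow> nat \<Rightarrow> real) \<Rightarrow> real" where
  "fdet r f = Determinant.det (Matrix.mat r r (\<lambda>(i, j). f i j))"

lemma fdet_cong:
  assumes "\<And>i j. i < r \<Longrightarrow> j < r \<Longrightarrow> f i j = g i j"
  shows "fdet r f = fdet r g"
  unfolding fdet_def using assms by (intro arg_cong[where f = Determinant.det] eq_matI) auto

lemma fdet_rows:
  "fdet r f = (\<Sum>p | p permutes {0..<r}. of_int (sign p) * (\<Prod>i = 0..<r. f i (p i)))"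
proof -
  have "fdet r f = (\<Sum>p | p permutes {0..<r}. of_int (sign p) *
          (\<Prod>i = 0..<r. Matrix.mat r r (\<lambda>(i, j). f i j) $$ (i, p i)))"
    unfolding fdet_def by (rule det_def') simp
  also have "\<dots> = (\<Sum>p | p permutes {0..<r}. of_int (sign p) * (\<Prod>i = 0..<r. f i (p i)))"
    by (intro sum.cong refl arg_cong2[where f = "(*)"] prod.cong)
       (auto dest: permutes_in_image[of _ "{0..<r}"])
  finally show ?thesis .
qed

lemma fdet_transpose: "fdet r (\<lambda>i j. f j i) = fdet r f"
proof -
  have "Matrix.mat r r (\<lambda>(i, j). f j i) = transpose_mat (Matrix.mat r r (\<lambda>(i, j). f i j))"
    by (intro eq_matI) auto
  then show ?thesis
    unfolding fdet_def by (simp add: det_transpose[of _ r])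
qed

lemma fdet_cols:
  "fdet r f = (\<Sum>p | p permutes {0..<r}. of_int (sign p) * (\<Prod>j = 0..<r. f (p j) j))"
  by (subst fdet_transpose[symmetric]) (rule fdet_rows)

lemma fdet_mult:
  "fdet r (\<lambda>i j. \<Sum>l = 0..<r. f i l * g l j) = fdet r f * fdet r g"
proof -
  have "Matrix.mat r r (\<lambda>(i, j). \<Sum>l = 0..<r. f i l * g l j)
          = Matrix.mat r r (\<lambda>(i, j). f i j) * Matrix.mat r r (\<lambda>(i, j). g i j)"
    by (intro eq_matI) (auto simp: scalar_prod_def)
  then show ?thesis
    unfolding fdet_def by (simp add: det_mult[of _ r])
qed

lemma fdet_scale:
  "fdet r (\<lambda>i j. u i * v j * f i j) = (\<Prod>i = 0..<r. u i) * (\<Prod>j = 0..<r. v j) * fdet r f"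
proof -
  have "(\<Prod>i = 0..<r. u i * v (p i) * f i (p i))
          = (\<Prod>i = 0..<r. u i) * (\<Prod>j = 0..<r. v j) * (\<Prod>i = 0..<r. f i (p i))"
    if "p permutes {0..<r}" for p
    using prod.permute[OF that, of v] by (simp add: prod.distrib o_def)
  then show ?thesis
    unfolding fdet_rows sum_distrib_left
    by (intro sum.cong refl) (simp add: mult_ac)
qed

lemma fdet_lower_triangular:
  assumes "\<And>i j. i < j \<Longrightarrow> j < r \<Longrightarrow> f i j = 0"
  shows "fdet r f = (\<Prod>i = 0..<r. f i i)"
proof -
  have "fdet r f = prod_list (diag_mat (Matrix.mat r r (\<lambda>(i, j). f i j)))"
    unfolding fdet_def using assms by (intro det_lower_triangular[of r]) auto
  also have "diag_mat (Matrix.mat r r (\<lambda>(i, j). f i j)) = map (\<lambda>i. f i i) [0..<r]"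
    unfolding diag_mat_def by (intro map_cong) auto
  also have "prod_list \<dots> = (\<Prod>i = 0..<r. f i i)"
    using prod.distinct_set_conv_list[of "[0..<r]" "\<lambda>i. f i i"] by simp
  finally show ?thesis .
qed

lemma fdet_upper_triangular:
  assumes "\<And>i j. j < i \<Longrightarrow> i < r \<Longrightarrow> f i j = 0"
  shows "fdet r f = (\<Prod>i = 0..<r. f i i)"
  using fdet_lower_triangular[of r "\<lambda>i j. f j i"] assms unfolding fdet_transpose[of r f] by blast

lemma fdet_permute_rows:
  assumes p: "p permutes {0..<r}"
  shows "fdet r (\<lambda>i j. f (p i) j) = of_int (sign p) * fdet r f"
proof -
  have "Matrix.mat r r (\<lambda>(i, j). Matrix.mat r r (\<lambda>(i, j). f i j) $$ (p i, j))
          = Matrix.mat r r (\<lambda>(i, j). f (p i) j)"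
    using permutes_in_image[OF p] by (intro eq_matI) auto
  then show ?thesis
    unfolding fdet_def using det_permute_rows[OF _ p, of "Matrix.mat r r (\<lambda>(i, j). f i j)"] by simp
qed

lemma fdet_permute_both:
  assumes p: "p permutes {0..<r}"
  shows "fdet r (\<lambda>i j. f (p i) (p j)) = fdet r f"
proof -
  have "fdet r (\<lambda>i j. f (p i) (p j)) = of_int (sign p) * fdet r (\<lambda>i j. f i (p j))"
    using fdet_permute_rows[OF p, of "\<lambda>i j. f i (p j)"] .
  also have "fdet r (\<lambda>i j. f i (p j)) = fdet r (\<lambda>i j. f j (p i))"
    using fdet_transpose[of r "\<lambda>i j. f j (p i)"] by simp
  also have "\<dots> = of_int (sign p) * fdet r (\<lambda>i j. f j i)"
    using fdet_permute_rows[OF p, of "\<lambda>i j. f j i"] .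
  also have "of_int (sign p) * (of_int (sign p) * fdet r (\<lambda>i j. f j i)) = fdet r f"
    unfolding fdet_transpose[of r f] by (simp add: sign_def)
  finally show ?thesis .
qed

lemma fdet_block_diagonal:
  assumes "\<And>i j. i < a \<Longrightarrow> j < b \<Longrightarrow> f i (a + j) = 0"
      and "\<And>i j. i < b \<Longrightarrow> j < a \<Longrightarrow> f (a + i) j = 0"
  shows "fdet (a + b) f = fdet a f * fdet b (\<lambda>i j. f (a + i) (a + j))"
proof -
  let ?A = "Matrix.mat a a (\<lambda>(i, j). f i j)"
  let ?D = "Matrix.mat b b (\<lambda>(i, j). f (a + i) (a + j))"
  have "Matrix.mat (a + b) (a + b) (\<lambda>(i, j). f i j) = four_block_mat ?A (0\<^sub>m a b) (0\<^sub>m b a) ?D"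
  proof (rule eq_matI)
    fix i j assume ij: "i < dim_row (four_block_mat ?A (0\<^sub>m a b) (0\<^sub>m b a) ?D)"
                       "j < dim_col (four_block_mat ?A (0\<^sub>m a b) (0\<^sub>m b a) ?D)"
    show "Matrix.mat (a + b) (a + b) (\<lambda>(i, j). f i j) $$ (i, j)
            = four_block_mat ?A (0\<^sub>m a b) (0\<^sub>m b a) ?D $$ (i, j)"
      using ij assms(1)[of i "j - a"] assms(2)[of "i - a" j]
      by (cases "i < a"; cases "j < a") auto
  qed auto
  then show ?thesis
    unfolding fdet_def by (simp add: det_four_block_mat_upper_right_zero[of _ a _ b])
qed

text \<open>The discrete form of the Cauchy--Binet--Andreief identity. Multiplying out both determinants
  by columns, the sum over \<open>k\<close> of each term \<open>(p, q)\<close> factorises into the inner products of \<open>a (p j)\<close> with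
  \<open>b (q j)\<close>. For fixed \<open>p\<close> the sum over \<open>q\<close> is the Gram determinant with its rows permuted by \<open>p\<close>; its sign
  cancels the sign of \<open>p\<close>, so that each of the \<open>r!\<close> permutations contributes the same amount.\<close>
lemma andreief:
  fixes a b :: "nat \<Rightarrow> 'a \<Rightarrow> real"
  assumes K: "finite K"
  shows "(\<Sum>k \<in> {1..r} \<rightarrow>\<^sub>E K. fdet r (\<lambda>i j. a i (k (Suc j))) * fdet r (\<lambda>i j. b i (k (Suc j))) *
            (\<Prod>i\<in>{1..r}. w (k i)))
         = fact r * fdet r (\<lambda>i j. \<Sum>x\<in>K. w x * a i x * b j x)"
proof -
  let ?S = "{p. p permutes {0..<r}}"
  let ?G = "\<lambda>i j. \<Sum>x\<in>K. w x * a i x * b j x"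
  have shift: "(\<Prod>i = 1..r. g i) = (\<Prod>j = 0..<r. g (Suc j))" for g :: "nat \<Rightarrow> real"
    by (rule prod.reindex_bij_witness[of _ Suc "\<lambda>i. i - 1"]) auto
  have fub: "(\<Sum>k \<in> {1..r} \<rightarrow>\<^sub>E K. \<Prod>j = 0..<r. h j (k (Suc j))) = (\<Prod>j = 0..<r. \<Sum>x\<in>K. h j x)"
    for h :: "nat \<Rightarrow> 'a \<Rightarrow> real"
  proof -
    have "(\<Prod>i = 1..r. \<Sum>x\<in>K. h (i - 1) x) = (\<Sum>k \<in> {1..r} \<rightarrow>\<^sub>E K. \<Prod>i = 1..r. h (i - 1) (k i))"
      using K by (intro prod_sum_PiE) auto
    then show ?thesis unfolding shift by simp
  qed
  have "(\<Sum>k \<in> {1..r} \<rightarrow>\<^sub>E K. fdet r (\<lambda>i j. a i (k (Suc j))) * fdet r (\<lambda>i j. b i (k (Suc j))) *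
            (\<Prod>i\<in>{1..r}. w (k i)))
      = (\<Sum>k \<in> {1..r} \<rightarrow>\<^sub>E K. \<Sum>p\<in>?S. \<Sum>q\<in>?S. of_int (sign p) * of_int (sign q) *
           (\<Prod>j = 0..<r. w (k (Suc j)) * a (p j) (k (Suc j)) * b (q j) (k (Suc j))))"
    unfolding fdet_cols sum_product sum_distrib_right shift prod.distrib
    by (intro sum.cong refl) (simp add: sum_distrib_left mult_ac)
  also have "\<dots> = (\<Sum>p\<in>?S. \<Sum>q\<in>?S. of_int (sign p) * of_int (sign q) *
           (\<Sum>k \<in> {1..r} \<rightarrow>\<^sub>E K. \<Prod>j = 0..<r. w (k (Suc j)) * a (p j) (k (Suc j)) * b (q j) (k (Suc j))))"
    unfolding sum_distrib_left
    by (subst sum.swap, rule sum.cong[OF refl], subst sum.swap, rule refl)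
  also have "\<dots> = (\<Sum>p\<in>?S. \<Sum>q\<in>?S. of_int (sign p) * of_int (sign q) * (\<Prod>j = 0..<r. ?G (p j) (q j)))"
    by (intro sum.cong refl arg_cong2[where f = "(*)"] fub)
  also have "\<dots> = (\<Sum>p\<in>?S. of_int (sign p) * fdet r (\<lambda>i j. ?G (p j) i))"
    unfolding fdet_cols sum_distrib_left by (simp add: mult_ac)
  also have "\<dots> = (\<Sum>p\<in>?S. fdet r ?G)"
  proof (rule sum.cong[OF refl])
    fix p assume "p \<in> ?S"
    then have p: "p permutes {0..<r}" by simp
    have "fdet r (\<lambda>i j. ?G (p j) i) = fdet r (\<lambda>i j. ?G (p i) j)"
      using fdet_transpose[of r "\<lambda>i j. ?G (p i) j"] by simp
    also have "\<dots> = of_int (sign p) * fdet r ?G"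
      using fdet_permute_rows[OF p, of ?G] .
    finally show "of_int (sign p) * fdet r (\<lambda>i j. ?G (p j) i) = fdet r ?G"
      by (simp add: sign_def)
  qed
  also have "\<dots> = fact r * fdet r ?G"
    by (simp add: card_permutations[of _ r])
  finally show ?thesis .
qed

section \<open>Polynomial alternants and determinants of reciprocal products\<close>

text \<open>The polynomial values factor through the coefficient matrix. The second factor is independent of the
  points \<open>x\<close>, which allows the determinant to be evaluated at other, more convenient points.\<close>
lemma fdet_poly_rows:
  fixes q :: "nat \<Rightarrow> real poly"
  assumes "\<And>j. j < r \<Longrightarrow> degree (q j) < r"
  shows "fdet r (\<lambda>i j. poly (q j) (x i)) = fdet r (\<lambda>i c. x i ^ c) * fdet r (\<lambda>c j. coeff (q j) c)"
proof -
  have "poly (q j) (x i) = (\<Sum>c = 0..<r. x i ^ c * coeff (q j) c)" if "j < r" for i j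
  proof -
    have "poly (q j) (x i) = (\<Sum>c\<le>degree (q j). coeff (q j) c * x i ^ c)"
      by (rule poly_altdef)
    also have "\<dots> = (\<Sum>c = 0..<r. coeff (q j) c * x i ^ c)"
      using assms[OF that] by (intro sum.mono_neutral_left) (auto simp: coeff_eq_0)
    finally show ?thesis by (simp add: mult_ac)
  qed
  then have "fdet r (\<lambda>i j. poly (q j) (x i)) = fdet r (\<lambda>i j. \<Sum>c = 0..<r. x i ^ c * coeff (q j) c)"
    by (intro fdet_cong) auto
  then show ?thesis by (simp add: fdet_mult)
qed

lemma fdet_poly_triangular:
  fixes q :: "nat \<Rightarrow> real poly"
  assumes "\<And>j. j < r \<Longrightarrow> degree (q j) \<le> j"
  shows "fdet r (\<lambda>i j. poly (q j) (x i)) = fdet r (\<lambda>i c. x i ^ c) * (\<Prod>j = 0..<r. coeff (q j) j)"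
proof -
  have "fdet r (\<lambda>c j. coeff (q j) c) = (\<Prod>j = 0..<r. coeff (q j) j)"
    using assms by (intro fdet_upper_triangular coeff_eq_0) (metis le_less_trans less_trans)
  then show ?thesis
    using assms by (subst fdet_poly_rows) (auto intro: le_less_trans)
qed

text \<open>By triangularity of the coefficient matrix the powers may be exchanged for the Newton basis
  \<open>\<Prod>l<j. (X - x l)\<close>, whose values at the points \<open>x i\<close> form a triangular matrix.\<close>
lemma vandermonde:
  "fdet r (\<lambda>i c. x i ^ c) = (\<Prod>i = 0..<r. \<Prod>l = 0..<i. x i - x l)"
proof -
  define N where "N j = (\<Prod>l = 0..<j. [:- x l, 1:])" for j
  have deg: "degree (N j) = j" for j
    unfolding N_def by (subst degree_prod_eq_sum_degree) auto
  have lead: "coeff (N j) j = 1" for j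
    using lead_coeff_prod[of "\<lambda>l. [:- x l, 1:]" "{0..<j}"] deg[of j] unfolding N_def by simp
  have eval: "poly (N j) y = (\<Prod>l = 0..<j. y - x l)" for j y
    unfolding N_def by (simp add: poly_prod)
  have "fdet r (\<lambda>i c. x i ^ c) = fdet r (\<lambda>i j. poly (N j) (x i))"
    using fdet_poly_triangular[of r N x] by (simp add: deg lead)
  also have "\<dots> = (\<Prod>i = 0..<r. poly (N i) (x i))"
    by (intro fdet_lower_triangular) (auto simp: eval)
  finally show ?thesis by (simp add: eval)
qed

text \<open>For \<open>d = 0\<close> this is a Cauchy determinant. Clearing denominators in row \<open>i\<close> turns column \<open>j\<close> into
  the values at \<open>s - i\<close> of the polynomial \<open>q j\<close>, the product of \<open>X - l\<close> over all \<open>l < r + d\<close> outside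
  \<open>{j..j + d}\<close>. Up to the ratio of two Vandermonde products, which is a sign, the determinant does not
  change when \<open>s - i\<close> is replaced by \<open>i\<close>; and \<open>q j\<close> vanishes at \<open>i\<close> for \<open>i < j\<close>, so the new matrix is triangular.\<close>
lemma fdet_reciprocal_products:
  fixes s :: real
  assumes nz: "\<And>i l. i < r \<Longrightarrow> l < r + d \<Longrightarrow> s - real i - real l \<noteq> 0"
  shows "fdet r (\<lambda>i j. 1 / (\<Prod>l = j..j + d. s - real i - real l))
       = (\<Prod>i = 0..<r. fact i * fact (i + d) / fact d / (\<Prod>l = 0..<r + d. s - real i - real l))"
proof -
  define q where "q j = (\<Prod>l\<in>{0..<r + d} - {j..j + d}. [:- real l, 1:])" for j
  define V where "V x = (\<Prod>i = 0..<r. \<Prod>l = 0..<i. x i - x l)" for x :: "nat \<Rightarrow> real"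
  have deg: "degree (q j) < r" if "j < r" for j
  proof -
    have "degree (q j) = card ({0..<r + d} - {j..j + d})"
      unfolding q_def by (subst degree_prod_eq_sum_degree) auto
    also have "\<dots> = r + d - Suc d"
      using that by (subst card_Diff_subset) auto
    finally show ?thesis using that by simp
  qed
  have eval: "poly (q j) y = (\<Prod>l\<in>{0..<r + d} - {j..j + d}. y - real l)" for j y
    unfolding q_def by (simp add: poly_prod)
  have entry: "1 / (\<Prod>l = j..j + d. s - real i - real l)
      = 1 / (\<Prod>l = 0..<r + d. s - real i - real l) * 1 * poly (q j) (s - real i)"
    if "i < r" "j < r" for i j
  proof -
    have "(\<Prod>l = 0..<r + d. s - real i - real l)
        = (\<Prod>l\<in>{0..<r + d} - {j..j + d}. s - real i - real l) * (\<Prod>l = j..j + d. s - real i - real l)"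
      using that by (intro prod.subset_diff) auto
    moreover have "(\<Prod>l\<in>{0..<r + d} - {j..j + d}. s - real i - real l) \<noteq> 0"
      using nz[OF that(1)] by auto
    ultimately show ?thesis by (simp add: eval)
  qed
  have V: "fdet r (\<lambda>i j. poly (q j) (x i)) = V x * fdet r (\<lambda>c j. coeff (q j) c)" for x
    using fdet_poly_rows[of r q x, OF deg] by (simp add: vandermonde V_def)
  have V_reflect: "V (\<lambda>i. s - real i) = (\<Prod>i = 0..<r. (-1) ^ i) * V real"
  proof -
    have "(\<Prod>l = 0..<i. (s - real i) - (s - real l)) = (-1) ^ i * (\<Prod>l = 0..<i. real i - real l)" for i
      using prod.distrib[of "\<lambda>_. -1" "\<lambda>l. real i - real l" "{0..<i}"] by (simp add: algebra_simps)
    then show ?thesis by (simp add: V_def prod.distrib)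
  qed
  have diag: "poly (q i) (real i) = (-1) ^ (r - Suc i) * (fact i * fact (r - Suc i + d) / fact d)"
    if "i < r" for i
  proof -
    have split: "{0..<r + d} - {i..i + d} = {0..<i} \<union> {i + Suc d..<r + d}"
      using that by auto
    have low: "(\<Prod>l = 0..<i. real i - real l) = fact i"
    proof -
      have "(\<Prod>l = 0..<i. real i - real l) = (\<Prod>l = 1..i. real l)"
        by (rule prod.reindex_bij_witness[of _ "\<lambda>l. i - l" "\<lambda>l. i - l"]) (auto simp: of_nat_diff)
      then show ?thesis by (simp add: fact_prod)
    qed
    have high: "(\<Prod>l = i + Suc d..<i + Suc d + e. real i - real l) = (-1) ^ e * (fact (e + d) / fact d)"
      for e
    proof (induction e)
      case (Suc e)
      have "(\<Prod>l = i + Suc d..<i + Suc d + Suc e. real i - real l)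
          = (\<Prod>l = i + Suc d..<i + Suc d + e. real i - real l) * (real i - real (i + Suc d + e))"
        by (simp add: prod.atLeastLessThan_Suc)
      then show ?case unfolding Suc by (simp add: algebra_simps)
    qed auto
    have rd: "i + Suc d + (r - Suc i) = r + d" using that by simp
    have "(\<Prod>l = i + Suc d..<r + d. real i - real l) = (-1) ^ (r - Suc i) * (fact (r - Suc i + d) / fact d)"
      using high[of "r - Suc i"] unfolding rd .
    then show ?thesis
      by (subst eval, subst split, subst prod.union_disjoint) (auto simp add: low)
  qed
  \<comment> \<open>Reversing one of the two products of factorials makes the signs those of the reflection above.\<close>
  have rev: "(\<Prod>i = 0..<r. g (r - Suc i)) = (\<Prod>i = 0..<r. g i)" for g :: "nat \<Rightarrow> real"
    using prod.nat_diff_reindex[of g r] by (simp add: atLeast0LessThan)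
  have at_nat: "fdet r (\<lambda>i j. poly (q j) (real i))
      = (\<Prod>i = 0..<r. (-1) ^ i) * (\<Prod>i = 0..<r. fact i * fact (i + d) / fact d)"
  proof -
    have "fdet r (\<lambda>i j. poly (q j) (real i)) = (\<Prod>i = 0..<r. poly (q i) (real i))"
    proof (rule fdet_lower_triangular)
      fix i j assume "i < j" "j < r"
      then have "i \<in> {0..<r + d} - {j..j + d}" by auto
      then show "poly (q j) (real i) = 0" unfolding eval by (auto intro!: prod_zero)
    qed
    also have "\<dots> = (\<Prod>i = 0..<r. (-1) ^ (r - Suc i) * (fact i * fact (r - Suc i + d) / fact d))"
      by (intro prod.cong refl diag) auto
    also have "\<dots> = (\<Prod>i = 0..<r. (-1) ^ (r - Suc i)) * (\<Prod>i = 0..<r. fact i) *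
                    (\<Prod>i = 0..<r. fact (r - Suc i + d) / fact d)"
      by (simp add: prod.distrib prod_dividef)
    also have "\<dots> = (\<Prod>i = 0..<r. (-1) ^ i) * (\<Prod>i = 0..<r. fact i) *
                    (\<Prod>i = 0..<r. fact (i + d) / fact d)"
      using rev[of "\<lambda>i. (-1) ^ i"] rev[of "\<lambda>i. fact (i + d) / fact d"] by simp
    finally show ?thesis by (simp add: prod.distrib prod_dividef)
  qed
  have "V real \<noteq> 0"
    unfolding V_def by auto
  \<comment> \<open>The sign of the reflection of the points cancels the sign of the diagonal.\<close>
  have sgn: "(\<Prod>i = 0..<r. (-1 :: real) ^ i) * (\<Prod>i = 0..<r. (-1) ^ i) = 1"
    by (simp add: prod.distrib[symmetric] power_mult_distrib[symmetric])
  have "fdet r (\<lambda>i j. poly (q j) (s - real i)) = (\<Prod>i = 0..<r. (-1) ^ i) * fdet r (\<lambda>i j. poly (q j) (real i))"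
    using V[of "\<lambda>i. s - real i"] V[of real] V_reflect by simp
  also have "\<dots> = (\<Prod>i = 0..<r. fact i * fact (i + d) / fact d)"
    unfolding at_nat mult.assoc[symmetric] sgn by simp
  finally have main: "fdet r (\<lambda>i j. poly (q j) (s - real i)) = (\<Prod>i = 0..<r. fact i * fact (i + d) / fact d)" .
  have "fdet r (\<lambda>i j. 1 / (\<Prod>l = j..j + d. s - real i - real l))
      = fdet r (\<lambda>i j. 1 / (\<Prod>l = 0..<r + d. s - real i - real l) * 1 * poly (q j) (s - real i))"
    by (intro fdet_cong entry)
  also have "\<dots> = (\<Prod>i = 0..<r. 1 / (\<Prod>l = 0..<r + d. s - real i - real l)) *
                  (\<Prod>i = 0..<r. fact i * fact (i + d) / fact d)"
    by (subst fdet_scale) (simp add: main)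
  finally show ?thesis by (simp add: prod.distrib[symmetric] mult_ac)
qed

section \<open>Moments of the binomial weight\<close>

definition central_binom :: "nat \<Rightarrow> int \<Rightarrow> real" where
  "central_binom n k = real (binom (2 * n) (int n + k))"

lemma central_binom_of_nat: "central_binom n (int k) = real ((2 * n) choose (n + k))"
  by (simp add: central_binom_def binom_def nat_add_distrib)

lemma central_binom_eq_0: "\<bar>k\<bar> > int n \<Longrightarrow> central_binom n k = 0"
  by (auto simp: central_binom_def binom_def intro!: binomial_eq_0)

lemma central_binom_minus: "central_binom n (- k) = central_binom n k"
proof (cases "\<bar>k\<bar> > int n")
  case False
  then have "nat (int n - k) \<le> 2 * n" "2 * n - nat (int n - k) = nat (int n + k)" by auto
  then show ?thesis
    using binomial_symmetric[of "nat (int n - k)" "2 * n"] False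
    by (auto simp: central_binom_def binom_def abs_less_iff not_less)
qed (simp add: central_binom_eq_0)

lemma real_choose_Suc: "(real k + 1) * real (N choose Suc k) = (real N - real k) * real (N choose k)"
proof (cases "k \<le> N")
  case True
  have "Suc k * (N choose Suc k) = (N - k) * (N choose k)"
    using binomial_absorb_comp[of N k] binomial_absorption[of k N] True
    by (cases N) (auto simp: mult_ac)
  then have "real (Suc k * (N choose Suc k)) = real ((N - k) * (N choose k))" by simp
  then show ?thesis using True by (simp add: of_nat_diff algebra_simps)
qed (simp add: binomial_eq_0)

text \<open>A factor \<open>(n + 1)\<^sup>2 - k\<^sup>2\<close> can be absorbed into the binomial coefficient, which merely lowers its
  parameter. This keeps all entries of the Gram matrix below within one family of moments.\<close>
lemma central_binom_lower:
  "((real n + 1)\<^sup>2 - (real_of_int k)\<^sup>2) * central_binom (Suc n) k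
     = (2 * real n + 2) * (2 * real n + 1) * central_binom n k"
proof (cases "int n + 1 + k \<le> 0")
  case True
  then have "central_binom n k = 0" by (intro central_binom_eq_0) auto
  moreover have "central_binom (Suc n) k = 0 \<or> k = - (int n + 1)"
    using True central_binom_eq_0[of "Suc n" k] by fastforce
  moreover have "(real n + 1)\<^sup>2 - (real_of_int k)\<^sup>2 = 0" if "k = - (int n + 1)"
    unfolding that by (simp add: power2_eq_square algebra_simps)
  ultimately show ?thesis by auto
next
  case False
  define K where "K = nat (int n + k)"
  have K: "real_of_int k = real K - real n" and nk: "nat (int n + k) = K" "nat (int (Suc n) + k) = Suc K"
    using False unfolding K_def by auto
  have a: "(real K + 1) * real (Suc (Suc (2 * n)) choose Suc K) = (2 * real n + 2) * real (Suc (2 * n) choose K)"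
    using Suc_times_binomial_eq[of "Suc (2 * n)" K] of_nat_mult[where ?'a = real]
    by (metis (no_types, opaque_lifting) Suc_eq_plus1 add.commute add_2_eq_Suc distrib_left_numeral mult.commute numeral_One of_nat_1 of_nat_add of_nat_mult of_nat_numeral one_add_one mult_2)
  have b: "(2 * real n + 1 - real K) * real (Suc (2 * n) choose K) = (2 * real n + 1) * real (2 * n choose K)"
  proof (cases "K \<le> Suc (2 * n)")
    case True
    have "(Suc (2 * n) - K) * (Suc (2 * n) choose K) = Suc (2 * n) * (2 * n choose K)"
      using binomial_absorb_comp[of "Suc (2 * n)" K] by simp
    then have "real (Suc (2 * n) - K) * real (Suc (2 * n) choose K) = real (Suc (2 * n)) * real (2 * n choose K)"
      by (metis of_nat_mult)
    then show ?thesis using True by (simp add: of_nat_diff algebra_simps)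
  qed (simp add: binomial_eq_0)
  have "((real n + 1)\<^sup>2 - (real_of_int k)\<^sup>2) * central_binom (Suc n) k
      = (2 * real n + 1 - real K) * ((real K + 1) * real (Suc (Suc (2 * n)) choose Suc K))"
    using False nk by (simp add: central_binom_def binom_def K power2_eq_square algebra_simps)
  also have "\<dots> = (2 * real n + 2) * ((2 * real n + 1 - real K) * real (Suc (2 * n) choose K))"
    unfolding a by (simp add: algebra_simps)
  also have "\<dots> = (2 * real n + 2) * (2 * real n + 1) * central_binom n k"
    unfolding b using False nk by (simp add: central_binom_def binom_def)
  finally show ?thesis .
qed

text \<open>Up to sign these are monic polynomials of degree \<open>l\<close> in \<open>k\<^sup>2\<close>. Being adapted to the binomial
  coefficient with parameter \<open>n\<close>, they replace the powers of \<open>k\<^sup>2\<close> in the Vandermonde determinant.\<close>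
definition even_basis :: "nat \<Rightarrow> nat \<Rightarrow> int \<Rightarrow> real" where
  "even_basis n l k = (\<Prod>t = 0..<l. (real (n - t))\<^sup>2 - (real_of_int k)\<^sup>2)"

lemma even_basis_central_binom:
  assumes "l \<le> n"
  shows "even_basis n l k * central_binom n k
           = fact (2 * n) / fact (2 * (n - l)) * central_binom (n - l) k"
  using assms
proof (induction l)
  case 0
  then show ?case by (simp add: even_basis_def)
next
  case (Suc l)
  define p where "p = n - Suc l"
  have p: "n - l = Suc p" using Suc.prems by (simp add: p_def)
  have f: "fact (2 * Suc p) = (2 * real p + 2) * (2 * real p + 1) * (fact (2 * p) :: real)"
    by (simp add: algebra_simps)
  have "even_basis n (Suc l) k * central_binom n k
      = ((real (Suc p))\<^sup>2 - (real_of_int k)\<^sup>2) * (even_basis n l k * central_binom n k)"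
    by (simp add: even_basis_def p)
  also have "\<dots> = fact (2 * n) / fact (2 * Suc p) * 
                    (((real p + 1)\<^sup>2 - (real_of_int k)\<^sup>2) * central_binom (Suc p) k)"
    using Suc by (simp add: p algebra_simps)
  also have "\<dots> = fact (2 * n) / fact (2 * p) * central_binom p k"
  proof -
    have "(2 * real p + 2) * (2 * real p + 1) \<noteq> 0"
      using of_nat_0_le_iff[of p, where ?'a = real] by (intro no_zero_divisors) linarith+
    moreover have "a / (x * b) * (x * y) = a / b * y" if "x \<noteq> 0" for a b x y :: real
      using that by simp
    ultimately show ?thesis unfolding central_binom_lower f by blast
  qed
  finally show ?case by (simp add: p_def)
qed

lemma sum_symmetric_interval:
  fixes f :: "int \<Rightarrow> real"
  assumes "\<And>k. f (- k) = f k" "f 0 = 0"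
  shows "(\<Sum>k = - int N..int N. f k) = 2 * (\<Sum>k = 1..N. f (int k))"
proof -
  have "{- int N..int N} = {- int N..-1} \<union> {0} \<union> {1..int N}" by auto
  then have "(\<Sum>k = - int N..int N. f k) = sum f {- int N..-1} + f 0 + sum f {1..int N}"
    by (simp add: sum.union_disjoint)
  moreover have "sum f {- int N..-1} = sum f {1..int N}"
    using assms(1) by (intro sum.reindex_bij_witness[of _ uminus uminus]) auto
  moreover have "sum f {1..int N} = (\<Sum>k = 1..N. f (int k))"
    by (rule sum.reindex_bij_witness[of _ int nat]) auto
  ultimately show ?thesis using assms(2) by simp
qed

text \<open>The sum telescopes: with \<open>t k = (n + k) (m + k) u k\<close>, where \<open>u\<close> is the product of the two binomial
  coefficients, \<open>t k - t (k + 1) = ((n + k) (m + k) - (n - k) (m - k)) u k = 2 (n + m) k u k\<close>.\<close>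
lemma abs_moment:
  assumes "n \<le> N" "n + m > 0"
  shows "(\<Sum>k = - int N..int N. of_int \<bar>k\<bar> * central_binom n k * central_binom m k)
       = real n * real m / (real n + real m) * central_binom n 0 * central_binom m 0"
proof -
  define u where "u k = central_binom n (int k) * central_binom m (int k)" for k
  define t where "t k = (real n + real k) * (real m + real k) * u k" for k
  have step: "(real p + real k + 1) * central_binom p (int (Suc k)) = (real p - real k) * central_binom p (int k)"
    for p k
    using real_choose_Suc[of "p + k" "2 * p"] unfolding central_binom_of_nat by (simp add: algebra_simps)
  have tS: "t (Suc k) = (real n - real k) * (real m - real k) * u k" for k
  proof -
    have "t (Suc k) = ((real n + real k + 1) * central_binom n (int (Suc k))) *
                      ((real m + real k + 1) * central_binom m (int (Suc k)))"
      unfolding t_def u_def by (simp add: algebra_simps)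
    then show ?thesis unfolding step u_def by (simp add: algebra_simps)
  qed
  have diff: "2 * (real n + real m) * (real k * u k) = t k - t (Suc k)" for k
    unfolding tS by (simp add: t_def algebra_simps)
  have "2 * (real n + real m) * (\<Sum>k = 1..N. real k * u k) = (\<Sum>k = 1..N. t k - t (Suc k))"
    unfolding sum_distrib_left by (intro sum.cong refl diff)
  also have "\<dots> = t 1 - t (Suc N)"
    using sum_Suc_diff[of 1 N "\<lambda>k. - t k"] by simp
  also have "t (Suc N) = 0"
    using assms by (simp add: t_def u_def central_binom_eq_0)
  also have "t 1 = real n * real m * central_binom n 0 * central_binom m 0"
    using tS[of 0] by (simp add: u_def)
  finally have "2 * (real n + real m) * (\<Sum>k = 1..N. real k * u k)
      = real n * real m * central_binom n 0 * central_binom m 0" by simp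
  moreover have "(\<Sum>k = - int N..int N. of_int \<bar>k\<bar> * central_binom n k * central_binom m k)
      = 2 * (\<Sum>k = 1..N. real k * u k)"
    by (subst sum_symmetric_interval) (auto simp: central_binom_minus u_def mult.assoc)
  ultimately have "(real n + real m) * (\<Sum>k = - int N..int N. of_int \<bar>k\<bar> * central_binom n k * central_binom m k)
      = real n * real m * central_binom n 0 * central_binom m 0" by (simp add: algebra_simps)
  moreover have "real n + real m \<noteq> 0" using assms(2) by linarith
  ultimately show ?thesis by (simp add: eq_divide_eq mult_ac)
qed

lemma central_binom_0: "central_binom n 0 = fact (2 * n) / (fact n)\<^sup>2"
  using binomial_fact[of n "2 * n", where ?'a = real]
  by (simp add: central_binom_def binom_def power2_eq_square)

text \<open>Writing \<open>k\<^sup>2 = n\<^sup>2 - (n\<^sup>2 - k\<^sup>2)\<close> reduces the third absolute moment to the first ones for the parameters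
  \<open>n\<close> and \<open>n - 1\<close>.\<close>
lemma abs_cubed_moment:
  assumes "n \<le> N" "n > 0" "m > 0"
  shows "(\<Sum>k = - int N..int N. of_int \<bar>k\<bar> * (of_int k)\<^sup>2 * central_binom n k * central_binom m k)
       = (real n)\<^sup>2 * (real m)\<^sup>2 / ((real n + real m) * (real n + real m - 1)) *
         central_binom n 0 * central_binom m 0"
proof -
  obtain p where p: "n = Suc p" using assms by (cases n) auto
  let ?a = "\<lambda>q k. of_int \<bar>k\<bar> * central_binom q k * central_binom m k"
  let ?c = "(2 * real p + 2) * (2 * real p + 1)"
  have "of_int \<bar>k\<bar> * (of_int k)\<^sup>2 * central_binom n k * central_binom m k
      = (real n)\<^sup>2 * ?a n k - ?c * ?a p k" for k
  proof -
    have "(of_int k)\<^sup>2 * central_binom n k = (real n)\<^sup>2 * central_binom n k - ?c * central_binom p k"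
      using central_binom_lower[of p k] by (simp add: p algebra_simps)
    then have "of_int \<bar>k\<bar> * central_binom m k * ((of_int k)\<^sup>2 * central_binom n k)
       = of_int \<bar>k\<bar> * central_binom m k * ((real n)\<^sup>2 * central_binom n k - ?c * central_binom p k)" by simp
    then show ?thesis by (simp only: algebra_simps)
  qed
  then have "(\<Sum>k = - int N..int N. of_int \<bar>k\<bar> * (of_int k)\<^sup>2 * central_binom n k * central_binom m k)
      = (real n)\<^sup>2 * (\<Sum>k = - int N..int N. ?a n k) - ?c * (\<Sum>k = - int N..int N. ?a p k)"
    by (simp add: sum_subtractf sum_distrib_left)
  also have "\<dots> = (real n)\<^sup>2 * (real n * real m / (real n + real m) * central_binom n 0 * central_binom m 0)
      - real p * real m / (real p + real m) * (?c * central_binom p 0) * central_binom m 0"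
    using assms by (subst (1 2) abs_moment) (auto simp: p)
  also have "?c * central_binom p 0 = (real n)\<^sup>2 * central_binom n 0"
    using central_binom_lower[of p 0] by (simp add: p algebra_simps)
  also have "real p = real n - 1" by (simp add: p)
  finally have 1: "(\<Sum>k = - int N..int N. of_int \<bar>k\<bar> * (of_int k)\<^sup>2 * central_binom n k * central_binom m k)
     = (real n)\<^sup>2 * central_binom n 0 * central_binom m 0 * real m *
       (real n / (real n + real m) - (real n - 1) / (real n + real m - 1))"
    by (simp add: algebra_simps)
  have "real n / (real n + real m) - (real n - 1) / (real n + real m - 1)
      = real m / ((real n + real m) * (real n + real m - 1))"
  proof -
    have "real n + real m \<noteq> 0" "real n + real m - 1 \<noteq> 0" using assms by linarith+
    then show ?thesis by (simp add: divide_simps) (simp add: algebra_simps)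
  qed
  then show ?thesis unfolding 1 by (simp add: power2_eq_square)
qed

section \<open>The sum as a product of two Gram determinants\<close>

text \<open>Listing the even indices before the odd ones makes the matrix block diagonal.\<close>
lemma fdet_checkerboard:
  assumes "\<And>i j. odd (i + j) \<Longrightarrow> f i j = 0"
  shows "fdet r f = fdet ((r + 1) div 2) (\<lambda>i j. f (2 * i) (2 * j)) *
                    fdet (r div 2) (\<lambda>i j. f (2 * i + 1) (2 * j + 1))"
proof -
  let ?R = "(r + 1) div 2"
  define p where "p i = (if i < ?R then 2 * i else if i < r then 2 * (i - ?R) + 1 else i)" for i
  have r: "r = ?R + r div 2" by presburger
  have "p permutes {0..<r}"
  proof (rule bij_imp_permutes)
    show "bij_betw p {0..<r} {0..<r}"
    proof (rule bij_betwI[where g = "\<lambda>i. if even i then i div 2 else ?R + i div 2"])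
      show "p \<in> {0..<r} \<rightarrow> {0..<r}" by (auto simp: p_def)
      show "(\<lambda>i. if even i then i div 2 else ?R + i div 2) \<in> {0..<r} \<rightarrow> {0..<r}"
        by (auto elim!: evenE oddE)
    qed (auto simp: p_def elim!: evenE oddE)
  qed (auto simp: p_def)
  then have "fdet r f = fdet (?R + r div 2) (\<lambda>i j. f (p i) (p j))"
    using fdet_permute_both[of p r f] r by simp
  also have "\<dots> = fdet ?R (\<lambda>i j. f (p i) (p j)) * fdet (r div 2) (\<lambda>i j. f (p (?R + i)) (p (?R + j)))"
    using r by (intro fdet_block_diagonal) (auto intro!: assms simp: p_def)
  also have "fdet ?R (\<lambda>i j. f (p i) (p j)) = fdet ?R (\<lambda>i j. f (2 * i) (2 * j))"
    by (intro fdet_cong) (auto simp: p_def)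
  also have "fdet (r div 2) (\<lambda>i j. f (p (?R + i)) (p (?R + j))) =
             fdet (r div 2) (\<lambda>i j. f (2 * i + 1) (2 * j + 1))"
    using r by (intro fdet_cong) (auto simp: p_def)
  finally show ?thesis .
qed

text \<open>The polynomial with index \<open>i\<close> has degree \<open>i\<close> and the parity of \<open>i\<close>; for an even weight, polynomials of
  opposite parity are orthogonal.\<close>
definition parity_basis :: "nat \<Rightarrow> nat \<Rightarrow> int \<Rightarrow> real" where
  "parity_basis n i k = (of_int k) ^ (i mod 2) * even_basis n (i div 2) k"

text \<open>The leading coefficients are signs that depend on \<open>i\<close> only, not on \<open>n\<close>. Hence in a product of two such
  determinants, for the parameters \<open>n\<close> and \<open>m\<close>, the signs cancel and the squared Vandermonde product is left.\<close>
lemma fdet_parity_basis: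
  "fdet r (\<lambda>i j. parity_basis n i (x j))
     = (\<Prod>i = 0..<r. (-1) ^ (i div 2)) * (\<Prod>i = 0..<r. \<Prod>l = 0..<i. of_int (x i) - of_int (x l))"
proof -
  define e where "e l = (\<Prod>t = 0..<l. [:(real (n - t))\<^sup>2, 0, -1:])" for l
  define q where "q i = monom 1 (i mod 2) * e (i div 2)" for i
  have e_deg: "degree (e l) = 2 * l" for l
    unfolding e_def by (subst degree_prod_eq_sum_degree) auto
  have e_lead: "coeff (e l) (2 * l) = (-1) ^ l" for l
    using lead_coeff_prod[of "\<lambda>t. [:(real (n - t))\<^sup>2, 0, -1:]" "{0..<l}"] e_deg[of l]
    unfolding e_def by simp
  have e0: "e l \<noteq> 0" for l
    using e_lead[of l] by auto
  have ev: "poly (q i) (of_int k) = parity_basis n i k" for i k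
    by (simp add: q_def e_def parity_basis_def even_basis_def poly_prod poly_monom power2_eq_square)
  have deg: "degree (q i) = i" for i
    unfolding q_def using e0[of "i div 2"]
    by (subst degree_mult_eq) (auto simp: monom_eq_0_iff degree_monom_eq e_deg)
  have lead: "coeff (q i) i = (-1) ^ (i div 2)" for i
    unfolding q_def coeff_monom_mult by (simp add: not_less minus_mod_eq_mult_div e_lead)
  have "fdet r (\<lambda>i j. parity_basis n i (x j)) = fdet r (\<lambda>i j. poly (q j) (of_int (x i)))"
    by (subst fdet_transpose[symmetric]) (simp add: ev)
  also have "\<dots> = fdet r (\<lambda>i c. of_int (x i) ^ c) * (\<Prod>j = 0..<r. coeff (q j) j)"
    by (rule fdet_poly_triangular) (simp add: deg)
  finally show ?thesis by (simp add: vandermonde lead)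
qed

lemma prod_pairs_shift:
  fixes g :: "nat \<Rightarrow> nat \<Rightarrow> real"
  shows "(\<Prod>i\<in>{1..r}. \<Prod>j\<in>{i<..r}. g i j) = (\<Prod>i = 0..<r. \<Prod>l = 0..<i. g (Suc l) (Suc i))"
  unfolding prod.Sigma[OF finite_atLeastAtMost ballI[OF finite_greaterThanAtMost]]
            prod.Sigma[OF finite_atLeastLessThan ballI[OF finite_atLeastLessThan]]
  by (rule prod.reindex_bij_witness[of _ "\<lambda>(i, l). (Suc l, Suc i)" "\<lambda>(i, j). (j - 1, i - 1)"]) auto

text \<open>One of the two Vandermonde factors is expanded in the basis for \<open>n\<close>, the other in the basis for \<open>m\<close>,
  so that each of the two binomial coefficients can absorb the basis adapted to it.\<close>
lemma weighted_sum_eq_fdet: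
  "weighted_sum r m n = fact r * fdet r (\<lambda>i j. \<Sum>k = - int n..int n.
      of_int \<bar>k\<bar> * central_binom n k * central_binom m k * parity_basis n i k * parity_basis m j k)"
proof -
  have "(\<Prod>i\<in>{1..r}. \<Prod>j\<in>{i<..r}. (of_int (k i - k j))\<^sup>2)
      = fdet r (\<lambda>i j. parity_basis n i (k (Suc j))) * fdet r (\<lambda>i j. parity_basis m i (k (Suc j)))"
    for k :: "nat \<Rightarrow> int"
  proof -
    let ?V = "\<Prod>i = 0..<r. \<Prod>l = 0..<i. of_int (k (Suc i)) - of_int (k (Suc l)) :: real"
    have "(\<Prod>i = 0..<r. (-1 :: real) ^ (i div 2)) * (\<Prod>i = 0..<r. (-1) ^ (i div 2)) = 1"
      by (simp add: prod.distrib[symmetric] power_mult_distrib[symmetric])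
    then have "fdet r (\<lambda>i j. parity_basis n i (k (Suc j))) * fdet r (\<lambda>i j. parity_basis m i (k (Suc j))) = ?V\<^sup>2"
      unfolding fdet_parity_basis power2_eq_square by (simp add: algebra_simps)
    also have "\<dots> = (\<Prod>i\<in>{1..r}. \<Prod>j\<in>{i<..r}. (of_int (k i - k j))\<^sup>2)"
      unfolding prod_pairs_shift by (simp add: prod_power_distrib power2_commute)
    finally show ?thesis by simp
  qed
  then show ?thesis
    using andreief[of "{- int n..int n}" r "parity_basis n" "parity_basis m"
        "\<lambda>k. of_int \<bar>k\<bar> * central_binom n k * central_binom m k"]
    unfolding weighted_sum_def central_binom_def by simp
qed

lemma gram_odd:
  assumes "odd (i + j)"
  shows "(\<Sum>k = - int N..int N. of_int \<bar>k\<bar> * central_binom n k * central_binom m k *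
            parity_basis n i k * parity_basis m j k) = 0"
proof -
  let ?f = "\<lambda>k. of_int \<bar>k\<bar> * central_binom n k * central_binom m k * parity_basis n i k * parity_basis m j k"
  have "(i mod 2 = 0 \<and> j mod 2 = 1) \<or> (i mod 2 = 1 \<and> j mod 2 = 0)"
    using assms by presburger
  then have "?f (- k) = - ?f k" for k
    by (auto simp: parity_basis_def even_basis_def central_binom_minus)
  then have "(\<Sum>k = - int N..int N. ?f k) = (\<Sum>k = - int N..int N. - ?f k)"
    by (intro sum.reindex_bij_witness[of _ uminus uminus]) auto
  then show ?thesis by (simp add: sum_negf)
qed

lemma gram_even:
  assumes "i < n" "j < m"
  shows "(\<Sum>k = - int n..int n. of_int \<bar>k\<bar> * central_binom n k * central_binom m k *
            parity_basis n (2 * i) k * parity_basis m (2 * j) k)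
       = (fact (2 * n) / (fact (n - i) * fact (n - Suc i))) * (fact (2 * m) / (fact (m - j) * fact (m - Suc j))) *
         (1 / (\<Prod>l = j..j + 0. real (m + n) - real i - real l))"
proof -
  let ?c = "fact (2 * n) / fact (2 * (n - i)) * (fact (2 * m) / fact (2 * (m - j))) :: real"
  have fs: "fact (n - i) = real (n - i) * fact (n - Suc i)" "fact (m - j) = real (m - j) * fact (m - Suc j)"
    using assms fact_reduce[of "n - i", where ?'a = real] fact_reduce[of "m - j", where ?'a = real] by auto
  have "of_int \<bar>k\<bar> * central_binom n k * central_binom m k * parity_basis n (2 * i) k * parity_basis m (2 * j) k
      = ?c * (of_int \<bar>k\<bar> * central_binom (n - i) k * central_binom (m - j) k)" for k
  proof -
    have "of_int \<bar>k\<bar> * central_binom n k * central_binom m k * parity_basis n (2 * i) k * parity_basis m (2 * j) k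
      = of_int \<bar>k\<bar> * (even_basis n i k * central_binom n k) * (even_basis m j k * central_binom m k)"
      by (simp add: parity_basis_def)
    then show ?thesis using assms by (simp add: even_basis_central_binom)
  qed
  then have "(\<Sum>k = - int n..int n. of_int \<bar>k\<bar> * central_binom n k * central_binom m k *
            parity_basis n (2 * i) k * parity_basis m (2 * j) k)
     = ?c * (\<Sum>k = - int n..int n. of_int \<bar>k\<bar> * central_binom (n - i) k * central_binom (m - j) k)"
    by (simp add: sum_distrib_left)
  also have "\<dots> = ?c * (real (n - i) * real (m - j) / (real (n - i) + real (m - j)) *
                   central_binom (n - i) 0 * central_binom (m - j) 0)"
    using assms by (subst abs_moment) auto
  also have "\<dots> = (fact (2 * n) / (fact (n - i) * fact (n - Suc i))) * (fact (2 * m) / (fact (m - j) * fact (m - Suc j))) *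
                  (1 / (real (n - i) + real (m - j)))"
    using assms unfolding central_binom_0 power2_eq_square fs by simp
  also have "real (n - i) + real (m - j) = real (m + n) - real i - real j"
    using assms by (simp add: of_nat_diff)
  finally show ?thesis by simp
qed

lemma gram_odd_odd:
  assumes "i < n" "j < m"
  shows "(\<Sum>k = - int n..int n. of_int \<bar>k\<bar> * central_binom n k * central_binom m k *
            parity_basis n (2 * i + 1) k * parity_basis m (2 * j + 1) k)
       = (fact (2 * n) / (fact (n - Suc i))\<^sup>2) * (fact (2 * m) / (fact (m - Suc j))\<^sup>2) *
         (1 / (\<Prod>l = j..j + 1. real (m + n) - real i - real l))"
proof -
  let ?c = "fact (2 * n) / fact (2 * (n - i)) * (fact (2 * m) / fact (2 * (m - j))) :: real"
  have fs: "fact (n - i) = real (n - i) * fact (n - Suc i)" "fact (m - j) = real (m - j) * fact (m - Suc j)"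
    using assms fact_reduce[of "n - i", where ?'a = real] fact_reduce[of "m - j", where ?'a = real] by auto
  have "of_int \<bar>k\<bar> * central_binom n k * central_binom m k * parity_basis n (2 * i + 1) k * parity_basis m (2 * j + 1) k
      = ?c * (of_int \<bar>k\<bar> * (of_int k)\<^sup>2 * central_binom (n - i) k * central_binom (m - j) k)" for k
  proof -
    have "of_int \<bar>k\<bar> * central_binom n k * central_binom m k * parity_basis n (2 * i + 1) k * parity_basis m (2 * j + 1) k
      = of_int \<bar>k\<bar> * (of_int k)\<^sup>2 * (even_basis n i k * central_binom n k) * (even_basis m j k * central_binom m k)"
      by (simp add: parity_basis_def power2_eq_square)
    then show ?thesis using assms by (simp add: even_basis_central_binom)
  qed
  then have "(\<Sum>k = - int n..int n. of_int \<bar>k\<bar> * central_binom n k * central_binom m k *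
            parity_basis n (2 * i + 1) k * parity_basis m (2 * j + 1) k)
     = ?c * (\<Sum>k = - int n..int n. of_int \<bar>k\<bar> * (of_int k)\<^sup>2 * central_binom (n - i) k * central_binom (m - j) k)"
    by (simp add: sum_distrib_left)
  also have "\<dots> = ?c * ((real (n - i))\<^sup>2 * (real (m - j))\<^sup>2 /
                   ((real (n - i) + real (m - j)) * (real (n - i) + real (m - j) - 1)) *
                   central_binom (n - i) 0 * central_binom (m - j) 0)"
    using assms by (subst abs_cubed_moment) auto
  also have "\<dots> = (fact (2 * n) / (fact (n - Suc i))\<^sup>2) * (fact (2 * m) / (fact (m - Suc j))\<^sup>2) *
                  (1 / ((real (n - i) + real (m - j)) * (real (n - i) + real (m - j) - 1)))"
    using assms unfolding central_binom_0 power2_eq_square fs by simp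
  also have "real (n - i) + real (m - j) = real (m + n) - real i - real j"
    using assms by (simp add: of_nat_diff)
  also have "(real (m + n) - real i - real j) * (real (m + n) - real i - real j - 1)
      = (\<Prod>l = j..j + 1. real (m + n) - real i - real l)"
    by (simp add: algebra_simps)
  finally show ?thesis .
qed

text \<open>After absorption the entries of both blocks are a row factor times a column factor times the
  reciprocal of \<open>d + 1\<close> consecutive factors, with \<open>d = 0\<close> in the even and \<open>d = 1\<close> in the odd block. The bounds on
  \<open>r\<close> keep all parameters \<open>n - i\<close> and \<open>m - j\<close> positive, and with them these factors.\<close>
lemma weighted_sum_product:
  assumes "r \<le> 2 * n" "r \<le> 2 * m"
  defines "R \<equiv> (r + 1) div 2" and "F \<equiv> r div 2"
  shows "weighted_sum r m n = fact r *
    (\<Prod>i = 0..<R. fact (2 * n) / (fact (n - i) * fact (n - Suc i)) *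
                   (fact (2 * m) / (fact (m - i) * fact (m - Suc i))) *
                   (fact i * fact i / (\<Prod>l = 0..<R. real (m + n) - real i - real l))) *
    (\<Prod>i = 0..<F. fact (2 * n) / (fact (n - Suc i))\<^sup>2 * (fact (2 * m) / (fact (m - Suc i))\<^sup>2) *
                   (fact i * fact (Suc i) / (\<Prod>l = 0..<F + 1. real (m + n) - real i - real l)))"
proof -
  let ?G = "\<lambda>i j. \<Sum>k = - int n..int n. of_int \<bar>k\<bar> * central_binom n k * central_binom m k *
               parity_basis n i k * parity_basis m j k"
  have R: "R \<le> n" "R \<le> m" and F: "F \<le> n" "F \<le> m"
    using assms by (auto simp: R_def F_def)
  have "fdet R (\<lambda>i j. ?G (2 * i) (2 * j)) = fdet R (\<lambda>i j.
       (fact (2 * n) / (fact (n - i) * fact (n - Suc i))) * (fact (2 * m) / (fact (m - j) * fact (m - Suc j))) *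
         (1 / (\<Prod>l = j..j + 0. real (m + n) - real i - real l)))"
    using R by (intro fdet_cong gram_even) auto
  also have "\<dots> = (\<Prod>i = 0..<R. fact (2 * n) / (fact (n - i) * fact (n - Suc i))) *
       (\<Prod>i = 0..<R. fact (2 * m) / (fact (m - i) * fact (m - Suc i))) *
       (\<Prod>i = 0..<R. fact i * fact (i + 0) / fact 0 / (\<Prod>l = 0..<R + 0. real (m + n) - real i - real l))"
    using R by (subst fdet_scale, subst fdet_reciprocal_products) auto
  finally have even: "fdet R (\<lambda>i j. ?G (2 * i) (2 * j)) = 
    (\<Prod>i = 0..<R. fact (2 * n) / (fact (n - i) * fact (n - Suc i)) *
                   (fact (2 * m) / (fact (m - i) * fact (m - Suc i))) *
                   (fact i * fact i / (\<Prod>l = 0..<R. real (m + n) - real i - real l)))"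
    by (simp only: prod.distrib prod_dividef add_0_right fact_0 div_by_1)
  have "fdet F (\<lambda>i j. ?G (2 * i + 1) (2 * j + 1)) = fdet F (\<lambda>i j.
       (fact (2 * n) / (fact (n - Suc i))\<^sup>2) * (fact (2 * m) / (fact (m - Suc j))\<^sup>2) *
         (1 / (\<Prod>l = j..j + 1. real (m + n) - real i - real l)))"
    using F by (intro fdet_cong gram_odd_odd) auto
  also have "\<dots> = (\<Prod>i = 0..<F. fact (2 * n) / (fact (n - Suc i))\<^sup>2) *
       (\<Prod>i = 0..<F. fact (2 * m) / (fact (m - Suc i))\<^sup>2) *
       (\<Prod>i = 0..<F. fact i * fact (i + 1) / fact 1 / (\<Prod>l = 0..<F + 1. real (m + n) - real i - real l))"
    using F by (subst fdet_scale, subst fdet_reciprocal_products) auto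
  finally have odd: "fdet F (\<lambda>i j. ?G (2 * i + 1) (2 * j + 1)) =
    (\<Prod>i = 0..<F. fact (2 * n) / (fact (n - Suc i))\<^sup>2 * (fact (2 * m) / (fact (m - Suc i))\<^sup>2) *
                   (fact i * fact (Suc i) / (\<Prod>l = 0..<F + 1. real (m + n) - real i - real l)))"
    by (simp only: prod.distrib prod_dividef Suc_eq_plus1 fact_1 div_by_1)
  have "fdet r ?G = fdet R (\<lambda>i j. ?G (2 * i) (2 * j)) * fdet F (\<lambda>i j. ?G (2 * i + 1) (2 * j + 1))"
    unfolding R_def F_def by (rule fdet_checkerboard) (rule gram_odd)
  then show ?thesis
    unfolding weighted_sum_eq_fdet even odd by simp
qed

section \<open>Both sides at natural arguments\<close>

lemma prod_falling_Gamma: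
  fixes x :: real
  assumes "x - real d + 1 > 0"
  shows "(\<Prod>l = 0..<d. x - real l) = Gamma (x + 1) / Gamma (x - real d + 1)"
  using assms
proof (induction d)
  case 0
  then have "Gamma (x + 1) > 0" by (intro Gamma_real_pos) simp
  then show ?case by simp
next
  case (Suc d)
  have pos: "x - real d > 0" using Suc.prems by simp
  then have "Gamma (x - real d + 1) = (x - real d) * Gamma (x - real d)"
    by (intro Gamma_plus1) (auto elim!: nonpos_Ints_cases)
  moreover have "(\<Prod>l = 0..<Suc d. x - real l) = Gamma (x + 1) / Gamma (x - real d + 1) * (x - real d)"
    using Suc.IH pos by simp
  moreover have "x - real (Suc d) + 1 = x - real d" by simp
  ultimately show ?case using pos by simp
qed

lemma floor_half: "\<lfloor>real r / 2\<rfloor> = int (r div 2)"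
  using floor_divide_of_nat_eq[of r 2, where ?'a = real] by simp

lemma ceiling_half: "\<lceil>real r / 2\<rceil> = int ((r + 1) div 2)"
  by (cases "even r") (auto elim!: evenE oddE simp: ceiling_unique)

lemma gamma_product_reindexed:
  "gamma_product r m n = fact r *
     (\<Prod>i = 0..<(r + 1) div 2. (fact i)\<^sup>2 * Gamma (2 * n + 1) * Gamma (2 * m + 1) *
         Gamma (m + n - real i - real ((r + 1) div 2) + 1) /
        (Gamma (n - real i + 1) * Gamma (n - real i) * Gamma (m - real i + 1) * Gamma (m - real i) *
         Gamma (m + n - real i + 1))) *
     (\<Prod>i = 0..<r div 2. fact i * fact (Suc i) * Gamma (2 * n + 1) * Gamma (2 * m + 1) *
         Gamma (m + n - real i - real (r div 2)) /
        ((Gamma (n - real i))\<^sup>2 * (Gamma (m - real i))\<^sup>2 * Gamma (m + n - real i + 1)))"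
proof -
  have shift: "(\<Prod>i = 1..N. g i) = (\<Prod>j = 0..<N. g (Suc j))" for g :: "nat \<Rightarrow> real" and N
    by (rule prod.reindex_bij_witness[of _ Suc "\<lambda>i. i - 1"]) auto
  have fact: "Gamma (real (Suc i)) = fact i" "Gamma (real (Suc i) + 1) = fact (Suc i)" for i
    using Gamma_fact[of i, where ?'a = real] Gamma_fact[of "Suc i", where ?'a = real]
    by (simp_all add: add_ac)
  have args: "x - real (Suc i) + 2 = x - real i + 1" "x - real (Suc i) + 1 = x - real i"
      "x - real (Suc i) - y + 2 = x - real i - y + 1" "x - real (Suc i) - y + 1 = x - real i - y" for i x y
    by simp_all
  show ?thesis
    unfolding gamma_product_def floor_half ceiling_half nat_int shift of_int_of_nat_eq fact args by (rule refl)
qed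

lemma gamma_product_nat:
  assumes "r \<le> 2 * n" "r \<le> 2 * m"
  shows "gamma_product r (real m) (real n) = weighted_sum r m n"
proof -
  define R where "R = (r + 1) div 2"
  define F where "F = r div 2"
  have R: "R \<le> n" "R \<le> m" and F: "F \<le> n" "F \<le> m"
    using assms by (auto simp: R_def F_def)
  have g1: "Gamma (2 * real p + 1) = fact (2 * p)" for p
    using Gamma_fact[of "2 * p", where ?'a = real] by (simp add: add_ac)
  have g2: "Gamma (real p - real i + 1) = fact (p - i)" if "i < p" for p i
    using Gamma_fact[of "p - i", where ?'a = real] that by (simp add: add_ac of_nat_diff)
  have g3: "Gamma (real p - real i) = fact (p - Suc i)" if "i < p" for p i
    using Gamma_fact[of "p - Suc i", where ?'a = real] that by (simp add: add_ac of_nat_diff)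
  \<comment> \<open>The common shape of the factors: the quotient of the two Gamma values with large arguments is the
    reciprocal of a falling product.\<close>
  have rat: "A * B * C * Gamma (x - real d + 1) / (E * Gamma (x + 1)) = B / E1 * (C / E2) * (A / (\<Prod>l = 0..<d. x - real l))"
    if "x - real d + 1 > 0" "E = E1 * E2" for A B C E E1 E2 x :: real and d
    unfolding prod_falling_Gamma[OF that(1)] that(2) by simp
  have even: "(fact i)\<^sup>2 * Gamma (2 * real n + 1) * Gamma (2 * real m + 1) *
         Gamma (real m + real n - real i - real R + 1) /
        (Gamma (real n - real i + 1) * Gamma (real n - real i) * Gamma (real m - real i + 1) * Gamma (real m - real i) *
         Gamma (real m + real n - real i + 1))
      = fact (2 * n) / (fact (n - i) * fact (n - Suc i)) * (fact (2 * m) / (fact (m - i) * fact (m - Suc i))) *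
                   (fact i * fact i / (\<Prod>l = 0..<R. real (m + n) - real i - real l))" if "i < R" for i
  proof -
    have "i < n" "i < m" "real m + real n - real i - real R + 1 > 0" using that R by linarith+
    then show ?thesis
      unfolding g1 of_nat_add power2_eq_square by (subst rat) (auto simp: g2 g3)
  qed
  have odd: "fact i * fact (Suc i) * Gamma (2 * real n + 1) * Gamma (2 * real m + 1) *
         Gamma (real m + real n - real i - real F) /
        ((Gamma (real n - real i))\<^sup>2 * (Gamma (real m - real i))\<^sup>2 * Gamma (real m + real n - real i + 1))
      = fact (2 * n) / (fact (n - Suc i))\<^sup>2 * (fact (2 * m) / (fact (m - Suc i))\<^sup>2) *
                   (fact i * fact (Suc i) / (\<Prod>l = 0..<F + 1. real (m + n) - real i - real l))" if "i < F" for i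
  proof -
    have i: "i < n" "i < m" and pos: "real m + real n - real i - real (F + 1) + 1 > 0"
      using that F by linarith+
    have "real m + real n - real i - real F = real m + real n - real i - real (F + 1) + 1" by simp
    then show ?thesis
      unfolding g1 of_nat_add[of m n] by (simp only: rat[OF pos refl] g3[OF i(1)] g3[OF i(2)])
  qed
  have "(\<Prod>i = 0..<R. (fact i)\<^sup>2 * Gamma (2 * real n + 1) * Gamma (2 * real m + 1) *
         Gamma (real m + real n - real i - real R + 1) /
        (Gamma (real n - real i + 1) * Gamma (real n - real i) * Gamma (real m - real i + 1) * Gamma (real m - real i) *
         Gamma (real m + real n - real i + 1)))
      = (\<Prod>i = 0..<R. fact (2 * n) / (fact (n - i) * fact (n - Suc i)) * (fact (2 * m) / (fact (m - i) * fact (m - Suc i))) *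
                   (fact i * fact i / (\<Prod>l = 0..<R. real (m + n) - real i - real l)))"
    by (intro prod.cong refl even) auto
  moreover have "(\<Prod>i = 0..<F. fact i * fact (Suc i) * Gamma (2 * real n + 1) * Gamma (2 * real m + 1) *
         Gamma (real m + real n - real i - real F) /
        ((Gamma (real n - real i))\<^sup>2 * (Gamma (real m - real i))\<^sup>2 * Gamma (real m + real n - real i + 1)))
      = (\<Prod>i = 0..<F. fact (2 * n) / (fact (n - Suc i))\<^sup>2 * (fact (2 * m) / (fact (m - Suc i))\<^sup>2) *
                   (fact i * fact (Suc i) / (\<Prod>l = 0..<F + 1. real (m + n) - real i - real l)))"
    by (intro prod.cong refl odd) auto
  ultimately show ?thesis
    unfolding gamma_product_reindexed weighted_sum_product[OF assms] R_def F_def by (simp only:)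
qed

text \<open>A nonzero summand needs \<open>r\<close> distinct values among the nonzero integers of absolute value at most
  \<open>min m n\<close>, of which there are only \<open>2 * min m n\<close>.\<close>
lemma weighted_sum_eq_0:
  assumes "r > 2 * min m n"
  shows "weighted_sum r m n = 0"
  unfolding weighted_sum_def
proof (rule sum.neutral, rule ballI)
  fix k assume k: "k \<in> {1..r} \<rightarrow>\<^sub>E {- int n..int n}"
  let ?N = "int (min m n)"
  show "(\<Prod>i\<in>{1..r}. \<Prod>j\<in>{i<..r}. (of_int (k i - k j))\<^sup>2) *
        (\<Prod>i\<in>{1..r}. of_int \<bar>k i\<bar> *
           real (binom (2 * n) (int n + k i)) * real (binom (2 * m) (int m + k i))) = (0 :: real)"
  proof (cases "k ` {1..r} \<subseteq> {- ?N..?N} - {0}")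
    case True
    have "card ({- ?N..?N} - {0}) = 2 * min m n" by simp
    then have "\<not> inj_on k {1..r}"
      using card_inj_on_le[OF _ True] assms by fastforce
    then obtain i j where "i \<in> {1..r}" "j \<in> {1..r}" "i < j" "k i = k j"
      unfolding inj_on_def by (metis linorder_neqE_nat)
    then have "(\<Prod>j\<in>{i<..r}. (of_int (k i - k j))\<^sup>2) = (0 :: real)" "i \<in> {1..r}"
      by (auto intro!: prod_zero bexI[of _ j])
    then have "(\<Prod>i\<in>{1..r}. \<Prod>j\<in>{i<..r}. (of_int (k i - k j))\<^sup>2) = (0 :: real)"
      by (intro prod_zero) auto
    then show ?thesis by simp
  next
    case False
    then obtain i where i: "i \<in> {1..r}" "k i = 0 \<or> \<bar>k i\<bar> > int n \<or> \<bar>k i\<bar> > int m"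
      by (auto simp: image_subset_iff min_def split: if_splits)
    then have "of_int \<bar>k i\<bar> * real (binom (2 * n) (int n + k i)) * real (binom (2 * m) (int m + k i)) = (0 :: real)"
      using central_binom_eq_0[of n "k i"] central_binom_eq_0[of m "k i"]
      unfolding central_binom_def by auto
    then have "(\<Prod>i\<in>{1..r}. of_int \<bar>k i\<bar> *
           real (binom (2 * n) (int n + k i)) * real (binom (2 * m) (int m + k i))) = (0 :: real)"
      by (intro prod_zero finite_atLeastAtMost bexI[OF _ i(1)])
    then show ?thesis by simp
  qed
qed

text \<open>The index \<open>i = min m n\<close> occurs in the first product, and there \<open>Gamma (n - i)\<close> or \<open>Gamma (m - i)\<close>
  is \<open>Gamma 0\<close>, so that the factor is a quotient with denominator \<open>0\<close>.\<close>
lemma gamma_product_nat_eq_0: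
  assumes "r > 2 * min m n"
  shows "gamma_product r (real m) (real n) = 0"
proof -
  have "min m n < (r + 1) div 2" using assms by linarith
  then have "(\<Prod>i = 0..<(r + 1) div 2. (fact i)\<^sup>2 * Gamma (2 * real n + 1) * Gamma (2 * real m + 1) *
         Gamma (real m + real n - real i - real ((r + 1) div 2) + 1) /
        (Gamma (real n - real i + 1) * Gamma (real n - real i) * Gamma (real m - real i + 1) * Gamma (real m - real i) *
         Gamma (real m + real n - real i + 1))) = 0"
    by (intro prod_zero bexI[of _ "min m n"]) (auto simp: min_def)
  then show ?thesis unfolding gamma_product_reindexed by simp
qed

lemma numerator_pole_imp:
  assumes "numerator_pole r m n"
  shows "r > 2 * min m n"
proof (rule ccontr)
  assume "\<not> r > 2 * min m n"
  then have r: "r \<le> 2 * m" "r \<le> 2 * n" by auto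
  have pos: "x \<notin> \<int>\<^sub>\<le>\<^sub>0" if "x > 0" for x :: real
    using that by (auto elim!: nonpos_Ints_cases)
  have "real m + real n - real i - real ((r + 1) div 2) + 2 > 0" if "i \<le> (r + 1) div 2" for i
    using r that by linarith
  moreover have "real m + real n - real i - real (r div 2) + 1 > 0" if "i \<le> r div 2" for i
    using r that by linarith
  ultimately show False
    using assms pos unfolding numerator_pole_def floor_half ceiling_half nat_int of_int_of_nat_eq
    by fastforce
qed

section \<open>Orders of vanishing and the limit at poles\<close>

text \<open>The function \<open>f\<close> has a zero of order at least \<open>d\<close> at \<open>0\<close>; a negative \<open>d\<close> allows a pole of order up to
  \<open>- d\<close>. These orders add under multiplication, so zeros and poles of a product can be counted.\<close>
definition zero_order_ge :: "int \<Rightarrow> (real \<Rightarrow> real) \<Rightarrow> bool" where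
  "zero_order_ge d f \<longleftrightarrow> (\<exists>c. ((\<lambda>x. f x * x powi (- d)) \<longlongrightarrow> c) (at 0))"

lemma zero_order_ge_tendsto:
  assumes "(f \<longlongrightarrow> c) (at 0)"
  shows "zero_order_ge 0 f"
  using assms unfolding zero_order_ge_def by auto

lemma zero_order_ge_mult:
  assumes "zero_order_ge d f" "zero_order_ge e g"
  shows "zero_order_ge (d + e) (\<lambda>x. f x * g x)"
proof -
  obtain a b where "((\<lambda>x. f x * x powi (- d)) \<longlongrightarrow> a) (at 0)" "((\<lambda>x. g x * x powi (- e)) \<longlongrightarrow> b) (at 0)"
    using assms unfolding zero_order_ge_def by auto
  then have "((\<lambda>x. (f x * x powi (- d)) * (g x * x powi (- e))) \<longlongrightarrow> a * b) (at 0)"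
    by (rule tendsto_mult)
  moreover have "\<forall>\<^sub>F x in at 0. (f x * x powi (- d)) * (g x * x powi (- e)) = f x * g x * x powi (- (d + e))"
    using eventually_neq_at_within[of 0 0 UNIV]
    by eventually_elim (simp add: power_int_add[of _ "- d" "- e", simplified])
  ultimately have "((\<lambda>x. f x * g x * x powi (- (d + e))) \<longlongrightarrow> a * b) (at 0)"
    by (rule Lim_transform_eventually)
  then show ?thesis
    unfolding zero_order_ge_def by blast
qed

lemma zero_order_ge_prod:
  fixes N :: nat
  assumes "\<And>i. zero_order_ge (d i) (f i)"
  shows "zero_order_ge (\<Sum>i = 0..<N. d i) (\<lambda>x. \<Prod>i = 0..<N. f i x)"
proof (induction N)
  case 0
  show ?case by (auto intro: zero_order_ge_tendsto tendsto_const)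
next
  case (Suc N)
  then show ?case using zero_order_ge_mult[OF Suc assms[of N]] by (simp add: add_ac mult_ac)
qed

lemma zero_order_ge_imp_tendsto_0:
  assumes "zero_order_ge d f" "d \<ge> 1"
  shows "(f \<longlongrightarrow> 0) (at 0)"
proof -
  obtain c where c: "((\<lambda>x. f x * x powi (- d)) \<longlongrightarrow> c) (at 0)"
    using assms(1) unfolding zero_order_ge_def by auto
  define e where "e = nat (d - 1)"
  have e: "d = int (Suc e)" using assms(2) by (simp add: e_def)
  have "((\<lambda>x. (f x * x powi (- d)) * x ^ Suc e) \<longlongrightarrow> c * 0 ^ Suc e) (at 0)"
    by (intro tendsto_mult c tendsto_power tendsto_ident_at)
  moreover have "\<forall>\<^sub>F x in at 0. (f x * x powi (- d)) * x ^ Suc e = f x"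
    using eventually_neq_at_within[of 0 0 UNIV]
    by eventually_elim (simp add: e power_int_minus del: of_nat_Suc power_Suc)
  ultimately have "(f \<longlongrightarrow> c * 0 ^ Suc e) (at 0)"
    by (rule Lim_transform_eventually)
  then show ?thesis by simp
qed

definition pole_order :: "int \<Rightarrow> int" where
  "pole_order a = (if a \<le> 0 then 1 else 0)"

lemma zero_order_ge_Gamma:
  assumes "c \<noteq> 0"
  shows "zero_order_ge (- pole_order a) (\<lambda>x. Gamma (of_int a + c * x))"
proof (cases "a \<le> 0")
  case True
  define N where "N = nat (- a)"
  have a: "real_of_int a = - of_nat N" using True by (simp add: N_def)
  have "filterlim (\<lambda>x. of_int a + c * x) (at (of_int a)) (at 0)"
    unfolding filterlim_at using assms
    by (auto intro!: tendsto_eq_intros simp: eventually_at_filter)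
  then have "((\<lambda>x. Gamma (of_int a + c * x) * ((of_int a + c * x) + of_nat N)) \<longlongrightarrow> (-1) ^ N / fact N) (at 0)"
    unfolding a by (rule filterlim_compose[OF Gamma_residues])
  then have "((\<lambda>x. Gamma (of_int a + c * x) * ((of_int a + c * x) + of_nat N) / c) \<longlongrightarrow> (-1) ^ N / fact N / c) (at 0)"
    by (rule tendsto_divide) (use assms in auto)
  then show ?thesis
    using True assms unfolding zero_order_ge_def pole_order_def by (auto simp: a mult_ac)
next
  case False
  have "isCont (\<lambda>x. Gamma (of_int a + c * x)) 0"
    using False by (intro isCont_Gamma) (auto intro!: continuous_intros elim!: nonpos_Ints_cases)
  then show ?thesis
    using False by (auto simp: pole_order_def isCont_def intro: zero_order_ge_tendsto)
qed

lemma zero_order_ge_inverse_Gamma: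
  "zero_order_ge (pole_order a) (\<lambda>x. inverse (Gamma (of_int a + c * x)))"
proof (cases "a \<le> 0")
  case True
  have 0: "rGamma (real_of_int a) = 0" using True by (simp add: rGamma_of_int)
  have "((\<lambda>x. real_of_int a + c * x) has_field_derivative c) (at 0)"
    by (auto intro!: derivative_eq_intros)
  from DERIV_chain2[OF has_field_derivative_rGamma this]
  obtain D where "((\<lambda>x. rGamma (of_int a + c * x)) has_field_derivative D) (at 0)"
    by blast
  then have "((\<lambda>h. (rGamma (of_int a + c * (0 + h)) - rGamma (of_int a + c * 0)) / h) \<longlongrightarrow> D) (at 0)"
    unfolding DERIV_def .
  then show ?thesis
    using True unfolding zero_order_ge_def pole_order_def rGamma_inverse_Gamma[symmetric]
    by (auto simp: 0 power_int_minus divide_inverse)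
next
  case False
  have "isCont (\<lambda>x. rGamma (of_int a + c * x)) 0"
    by (intro continuous_intros)
  then show ?thesis
    using False unfolding pole_order_def rGamma_inverse_Gamma[symmetric]
    by (auto simp: isCont_def intro: zero_order_ge_tendsto)
qed

lemma sum_pole_order:
  "(\<Sum>i = 0..<N. pole_order (a - int i)) = max 0 (min (int N) (int N - a))"
  by (induction N) (auto simp: pole_order_def)

text \<open>The product has more zeros than poles at \<open>\<epsilon> = 0\<close>. Let \<open>S N a\<close> be the number of \<open>i < N\<close> with \<open>a \<le> i\<close>, where
  \<open>N = R\<close> for the first product and \<open>N = F\<close> for the second. The numerators have \<open>S R (m + n - R + 1)\<close> and
  \<open>S F (m + n - F)\<close> poles. A positive number of these is at most \<open>(R - n) + (R - m) - 1\<close> and \<open>(F - n) + (F - m)\<close>,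
  respectively, while the factors \<open>1 / Gamma (n - i + \<epsilon>)\<close> and \<open>1 / Gamma (m - i + \<epsilon>)\<close> already have
  at least \<open>N - n\<close> and \<open>N - m\<close> zeros. If the first numerator has no pole, then \<open>R > min m n\<close> gives the
  required zero.\<close>
lemma gamma_product_tendsto_0:
  assumes r: "r > 2 * min m n"
  shows "((\<lambda>\<epsilon>. gamma_product r (real m + \<epsilon>) (real n + \<epsilon>)) \<longlongrightarrow> 0) (at 0)"
proof -
  define R where "R = (r + 1) div 2"
  define F where "F = r div 2"
  let ?s = "int m + int n"
  let ?G = "\<lambda>a c x. Gamma (real_of_int a + c * x)"
  let ?d1 = "\<lambda>i. 0 + 0 + - pole_order (?s - int R + 1 - int i) +
    (pole_order (int n + 1 - int i) + pole_order (int n - int i) +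
     pole_order (int m + 1 - int i) + pole_order (int m - int i) + pole_order (?s + 1 - int i))"
  let ?d2 = "\<lambda>i. 0 + 0 + - pole_order (?s - int F - int i) +
    (pole_order (int n - int i) + pole_order (int n - int i) +
     pole_order (int m - int i) + pole_order (int m - int i) + pole_order (?s + 1 - int i))"
  let ?f1 = "\<lambda>i x. (fact i)\<^sup>2 * ?G (2 * int n + 1) 2 x * ?G (2 * int m + 1) 2 x * ?G (?s - int R + 1 - int i) 2 x *
    (inverse (?G (int n + 1 - int i) 1 x) * inverse (?G (int n - int i) 1 x) *
     inverse (?G (int m + 1 - int i) 1 x) * inverse (?G (int m - int i) 1 x) * inverse (?G (?s + 1 - int i) 2 x))"
  let ?f2 = "\<lambda>i x. fact i * fact (Suc i) * ?G (2 * int n + 1) 2 x * ?G (2 * int m + 1) 2 x * ?G (?s - int F - int i) 2 x *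
    (inverse (?G (int n - int i) 1 x) * inverse (?G (int n - int i) 1 x) *
     inverse (?G (int m - int i) 1 x) * inverse (?G (int m - int i) 1 x) * inverse (?G (?s + 1 - int i) 2 x))"
  have const: "zero_order_ge 0 (\<lambda>x. c * ?G (2 * int p + 1) 2 x)" for p c
  proof -
    have "isCont (\<lambda>x. c * ?G (2 * int p + 1) 2 x) 0"
      by (intro continuous_intros) (auto elim!: nonpos_Ints_cases)
    then show ?thesis by (auto simp: isCont_def intro: zero_order_ge_tendsto)
  qed
  have const1: "zero_order_ge 0 (\<lambda>x. ?G (2 * int p + 1) 2 x)" for p
    using const[of 1 p] by simp
  have o1: "zero_order_ge (?d1 i) (?f1 i)" for i
    by (intro zero_order_ge_mult zero_order_ge_inverse_Gamma zero_order_ge_Gamma const const1) auto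
  have o2: "zero_order_ge (?d2 i) (?f2 i)" for i
    by (intro zero_order_ge_mult zero_order_ge_inverse_Gamma zero_order_ge_Gamma const const1) auto
  have "zero_order_ge (0 + (\<Sum>i = 0..<R. ?d1 i) + (\<Sum>i = 0..<F. ?d2 i))
          (\<lambda>x. fact r * (\<Prod>i = 0..<R. ?f1 i x) * (\<Prod>i = 0..<F. ?f2 i x))"
    by (rule zero_order_ge_mult[OF zero_order_ge_mult[OF zero_order_ge_tendsto[OF tendsto_const]
                zero_order_ge_prod[OF o1]] zero_order_ge_prod[OF o2]])
  moreover have "fact r * (\<Prod>i = 0..<R. ?f1 i x) * (\<Prod>i = 0..<F. ?f2 i x)
      = gamma_product r (real m + x) (real n + x)" for x
    unfolding gamma_product_reindexed R_def[symmetric] F_def[symmetric]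
    by (intro arg_cong2[where f = "(*)"] prod.cong refl)
       (simp_all add: divide_inverse power2_eq_square algebra_simps)
  moreover have "0 + (\<Sum>i = 0..<R. ?d1 i) + (\<Sum>i = 0..<F. ?d2 i) \<ge> 1"
  proof -
    let ?S = "\<lambda>N a. \<Sum>i = 0..<N. pole_order (a - int i)"
    have S: "?S N a \<ge> 0" "a \<ge> 0 \<Longrightarrow> ?S N a \<ge> int N - a" "?S N a \<le> 0 \<or> ?S N a \<le> int N - a" for N a
      unfolding sum_pole_order by auto
    have "R = F \<or> R = F + 1" "r = R + F" unfolding R_def F_def by presburger+
    then have large: "int R > int n \<or> int R > int m" using r by auto
    have "?S R (int n + 1) + ?S R (int n) + ?S R (int m + 1) + ?S R (int m)
            \<ge> ?S R (?s - int R + 1) + 1"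
      using large S(1)[of "int n + 1" R] S(1)[of "int m + 1" R] S(1)[of "int n" R] S(1)[of "int m" R]
        S(2)[of "int n" R] S(2)[of "int m" R] S(3)[of "?s - int R + 1" R] by linarith
    moreover have "?S F (int n) + ?S F (int n) + ?S F (int m) + ?S F (int m) \<ge> ?S F (?s - int F)"
      using S(1)[of "int n" F] S(1)[of "int m" F]
        S(2)[of "int n" F] S(2)[of "int m" F] S(3)[of "?s - int F" F] by linarith
    ultimately show ?thesis
      using S(1)[of "?s + 1" R] S(1)[of "?s + 1" F]
      unfolding sum.distrib sum_negf sum.neutral_const by linarith
  qed
  ultimately show ?thesis
    using zero_order_ge_imp_tendsto_0 by simp
qed

section \<open>The summation formula\<close>

theorem proposition7p2:
  fixes m n r :: nat
  assumes "r \<ge> 1"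
  shows "(\<not> numerator_pole r m n \<longrightarrow>
            weighted_sum r m n = gamma_product r (real m) (real n)) \<and>
         (numerator_pole r m n \<longrightarrow>
            ((\<lambda>\<epsilon>. gamma_product r (real m + \<epsilon>) (real n + \<epsilon>))
               \<longlongrightarrow> weighted_sum r m n) (at 0))"
proof (cases "r > 2 * min m n")
  case True
  then show ?thesis
    by (simp add: weighted_sum_eq_0 gamma_product_nat_eq_0 gamma_product_tendsto_0)
next
  case False
  then show ?thesis
    using numerator_pole_imp[of r m n] gamma_product_nat[of r n m] by auto
qed

end
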